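(* Let $k,n$ be integers with $2\le k<n$, and let $Q$ be a prime power with $Q\ge n+1$. Then the $(k,n)$-Shamir threshold scheme over $\mathbb{F}_Q$ (which has information rate $1$) has a share-repairing protocol making it a $(k,n,k)$-RTS with universal repairability, i.e. any $k$ players can repair the share of any other player. The communication complexity of this repairing protocol is $k^2$.
   Context: Threshold schemes. For $2\le k\le n$, a $(k,n)$-threshold scheme is a (randomized) method by which a dealer chooses a secret from a finite set $\mathcal{K}$ and gives a share, from a finite set $\mathcal{S}$ of possible shares, to each of $n$ players $P_1,\dots,P_n$, such that any $k$ players can compute the secret from their shares, and no $k-1$ players obtain any information about the secret (unconditionally: the distribution of their shares does not depend on the secret). Its information rate is $\log_2|\mathcal{K}|/\log_2|\mathcal{S}|$. Shamir scheme. The dealer fixes distinct public nonzero elements $x_1,\dots,x_n\in\mathbb{F}_Q$. To share a secret $a_0\in\mathbb{F}_Q$, the dealer chooses $a_1,\dots,a_{k-1}\in\mathbb{F}_Q$ independently and uniformly at random and gives $P_i$ the share $a(x_i)$, where $a(x)=\sum_{j=0}^{k-1}a_jx^j$. Repairing. A repairing protocol lets a player $P_\ell$ who lost their share recover exactly that share, without the dealer, with help from a set of $d$ other players ($d$ is the repairing degree), over secure pairwise channels. It has two phases. In the message exchange phase (possibly empty) each of the $d$ players, using their own share and private randomness, simultaneously sends at most one message to each other member of the set. In the repairing phase each of the $d$ players sends a message to $P_\ell$ (depending on their share, randomness and the messages received), from which $P_\ell$ computes the lost share. Security: all players follow the protocol honestly, and for every coalition of $k-1$ players (which may or may not include $P_\ell$),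 the shares of the coalition together with all messages its members sent or received in the execution of the protocol give no information about the secret. A $(k,n)$-threshold scheme with such a secure protocol with repairing degree $d$ is a $(k,n,d)$-RTS (repairable threshold scheme). It has universal repairability if any set of $d$ players can repair the share of any other player. The communication complexity of a repairing protocol is the sum of the bit-lengths of all messages transmitted divided by the bit-length of the secret (an element of a set of size $N$ has bit-length $\log_2 N$). *)

theory Defs
  imports "HOL-Probability.Probability" "HOL-Number_Theory.Number_Theory"
begin

text \<open>
  Players are the numbers \<open>1, \<dots>, n\<close>. A distribution of shares is a function from players to
  shares; what a set of players holds is its restriction to that set
  (\<^const>\<open>restrict\<close> makes the other values irrelevant).
\<close>

record ('k, 's) sharing_scheme =
  secrets :: "'k set"
  shares :: "'s set"
  deal :: "'k \<Rightarrow> (nat \<Rightarrow> 's) pmf"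

definition threshold_scheme :: "nat \<Rightarrow> nat \<Rightarrow> ('k, 's) sharing_scheme \<Rightarrow> bool" where
  "threshold_scheme k n \<Sigma> \<longleftrightarrow>
     2 \<le> k \<and> k \<le> n \<and>
     finite (secrets \<Sigma>) \<and> secrets \<Sigma> \<noteq> {} \<and> finite (shares \<Sigma>) \<and>
     (\<forall>s\<in>secrets \<Sigma>. \<forall>f\<in>set_pmf (deal \<Sigma> s). \<forall>i\<in>{1..n}. f i \<in> shares \<Sigma>) \<and>
     (\<forall>A\<subseteq>{1..n}. card A = k \<longrightarrow>
        (\<exists>reconstruct. \<forall>s\<in>secrets \<Sigma>. \<forall>f\<in>set_pmf (deal \<Sigma> s).
           reconstruct (restrict f A) = s)) \<and>
     (\<forall>A\<subseteq>{1..n}. card A = k - 1 \<longrightarrow>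
        (\<forall>s\<in>secrets \<Sigma>. \<forall>s'\<in>secrets \<Sigma>.
           map_pmf (\<lambda>f. restrict f A) (deal \<Sigma> s) = map_pmf (\<lambda>f. restrict f A) (deal \<Sigma> s')))"

definition information_rate :: "('k, 's) sharing_scheme \<Rightarrow> real" where
  "information_rate \<Sigma> = log 2 (card (secrets \<Sigma>)) / log 2 (card (shares \<Sigma>))"

text \<open>The coefficients other than the constant one, which is the secret, are independent and
  uniform.\<close>

definition shamir ::
  "nat \<Rightarrow> nat \<Rightarrow> (nat \<Rightarrow> 'a::{field,finite}) \<Rightarrow> ('a, 'a) sharing_scheme" where
  "shamir k n x =
     \<lparr> secrets = UNIV,
       shares = UNIV,
       deal = (\<lambda>s. map_pmf (\<lambda>a. \<lambda>i\<in>{1..n}. \<Sum>j<k. (a(0 := s)) j * x i ^ j)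
                     (Pi_pmf {1..<k} 0 (\<lambda>_. pmf_of_set UNIV))) \<rparr>"

text \<open>
  A protocol for one fixed helper set \<open>D\<close> and one fixed player \<open>l\<close> whose share is lost, with
  share type \<open>'s\<close>, randomness type \<open>'r\<close> and message type \<open>'m\<close>.
  A pair \<open>(i, j)\<close> in \<open>links\<close> means that \<open>i\<close> sends one message to \<open>j\<close> in the message exchange
  phase; this message depends only on the share and the randomness of \<open>i\<close>. The message
  \<open>reply i\<close> that helper \<open>i\<close> sends to \<open>l\<close> depends in addition on the messages received by \<open>i\<close>,
  indexed by their senders.
\<close>

record ('s, 'r, 'm) repair_protocol =
  links :: "(nat \<times> nat) set"
  randomness :: "nat \<Rightarrow> 'r pmf"
  exchange :: "nat \<Rightarrow> nat \<Rightarrow> 's \<Rightarrow> 'r \<Rightarrow> 'm"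
  reply :: "nat \<Rightarrow> 's \<Rightarrow> 'r \<Rightarrow> (nat \<Rightarrow> 'm) \<Rightarrow> 'm"
  recover :: "(nat \<Rightarrow> 'm) \<Rightarrow> 's"

definition exchanged ::
  "('s, 'r, 'm) repair_protocol \<Rightarrow> (nat \<Rightarrow> 's) \<Rightarrow> (nat \<Rightarrow> 'r) \<Rightarrow> nat \<times> nat \<Rightarrow> 'm" where
  "exchanged P f r = (\<lambda>(i, j)\<in>links P. exchange P i j (f i) (r i))"

definition received ::
  "('s, 'r, 'm) repair_protocol \<Rightarrow> (nat \<Rightarrow> 's) \<Rightarrow> (nat \<Rightarrow> 'r) \<Rightarrow> nat \<Rightarrow> nat \<Rightarrow> 'm" where
  "received P f r j = (\<lambda>i\<in>{i. (i, j) \<in> links P}. exchanged P f r (i, j))"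

definition replies ::
  "nat set \<Rightarrow> ('s, 'r, 'm) repair_protocol \<Rightarrow> (nat \<Rightarrow> 's) \<Rightarrow> (nat \<Rightarrow> 'r) \<Rightarrow> nat \<Rightarrow> 'm" where
  "replies D P f r = (\<lambda>i\<in>D. reply P i (f i) (r i) (received P f r i))"

text \<open>All players follow the protocol. An execution is determined by the dealt shares \<open>f\<close> and
  the helpers' randomness \<open>r\<close>, which is independent between helpers and of the shares.\<close>

definition execution ::
  "('k, 's) sharing_scheme \<Rightarrow> nat set \<Rightarrow> ('s, 'r, 'm) repair_protocol \<Rightarrow> 'k
     \<Rightarrow> ((nat \<Rightarrow> 's) \<times> (nat \<Rightarrow> 'r)) pmf" where
  "execution \<Sigma> D P s = pair_pmf (deal \<Sigma> s) (Pi_pmf D undefined (randomness P))"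

text \<open>The shares of the coalition \<open>C\<close>, and all messages of both phases that its members sent or
  received. A member \<open>l\<close> contributes the share that was lost, and receives all replies.\<close>

definition view ::
  "nat \<Rightarrow> nat set \<Rightarrow> ('s, 'r, 'm) repair_protocol \<Rightarrow> nat set \<Rightarrow> (nat \<Rightarrow> 's) \<times> (nat \<Rightarrow> 'r)
     \<Rightarrow> (nat \<Rightarrow> 's) \<times> (nat \<times> nat \<Rightarrow> 'm) \<times> (nat \<Rightarrow> 'm)" where
  "view l D P C = (\<lambda>(f, r).
     (restrict f C,
      restrict (exchanged P f r) {(i, j) \<in> links P. i \<in> C \<or> j \<in> C},
      restrict (replies D P f r) {i \<in> D. i \<in> C \<or> l \<in> C}))"

definition exchange_messages ::
  "('k, 's) sharing_scheme \<Rightarrow> nat set \<Rightarrow> ('s, 'r, 'm) repair_protocol \<Rightarrow> nat \<times> nat \<Rightarrow> 'm set" where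
  "exchange_messages \<Sigma> D P e =
     {exchanged P f r e | s f r. s \<in> secrets \<Sigma> \<and> (f, r) \<in> set_pmf (execution \<Sigma> D P s)}"

definition reply_messages ::
  "('k, 's) sharing_scheme \<Rightarrow> nat set \<Rightarrow> ('s, 'r, 'm) repair_protocol \<Rightarrow> nat \<Rightarrow> 'm set" where
  "reply_messages \<Sigma> D P i =
     {replies D P f r i | s f r. s \<in> secrets \<Sigma> \<and> (f, r) \<in> set_pmf (execution \<Sigma> D P s)}"

definition secure_repair ::
  "nat \<Rightarrow> nat \<Rightarrow> ('k, 's) sharing_scheme \<Rightarrow> nat \<Rightarrow> nat set \<Rightarrow> ('s, 'r, 'm) repair_protocol
     \<Rightarrow> bool" where
  "secure_repair k n \<Sigma> l D P \<longleftrightarrow>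
     links P \<subseteq> {(i, j). i \<in> D \<and> j \<in> D \<and> i \<noteq> j} \<and>
     (\<forall>e\<in>links P. finite (exchange_messages \<Sigma> D P e)) \<and>
     (\<forall>i\<in>D. finite (reply_messages \<Sigma> D P i)) \<and>
     (\<forall>s\<in>secrets \<Sigma>. \<forall>(f, r)\<in>set_pmf (execution \<Sigma> D P s). recover P (replies D P f r) = f l) \<and>
     (\<forall>C\<subseteq>{1..n}. card C = k - 1 \<longrightarrow>
        (\<forall>s\<in>secrets \<Sigma>. \<forall>s'\<in>secrets \<Sigma>.
           map_pmf (view l D P C) (execution \<Sigma> D P s) =
           map_pmf (view l D P C) (execution \<Sigma> D P s')))"

text \<open>The bit-length of a message is that of an element of the set of its possible values, so
  that declaring needlessly large message sets cannot change the communication complexity.\<close>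

definition communication_complexity ::
  "('k, 's) sharing_scheme \<Rightarrow> nat set \<Rightarrow> ('s, 'r, 'm) repair_protocol \<Rightarrow> real" where
  "communication_complexity \<Sigma> D P =
     ((\<Sum>e\<in>links P. log 2 (card (exchange_messages \<Sigma> D P e))) +
      (\<Sum>i\<in>D. log 2 (card (reply_messages \<Sigma> D P i)))) / log 2 (card (secrets \<Sigma>))"

text \<open>The protocol is a family: \<open>\<rho> l D\<close> is what is run to repair the share of \<open>l\<close> with the
  helpers \<open>D\<close>. The value \<open>\<rho> l D\<close> is arbitrary where \<open>D\<close> is unable to repair the share of \<open>l\<close>.\<close>

definition repairable_threshold_scheme ::
  "nat \<Rightarrow> nat \<Rightarrow> nat \<Rightarrow> ('k, 's) sharing_scheme
     \<Rightarrow> (nat \<Rightarrow> nat set \<Rightarrow> ('s, 'r, 'm) repair_protocol) \<Rightarrow> bool" where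
  "repairable_threshold_scheme k n d \<Sigma> \<rho> \<longleftrightarrow>
     threshold_scheme k n \<Sigma> \<and>
     (\<forall>l\<in>{1..n}. \<exists>D\<subseteq>{1..n} - {l}. card D = d \<and> secure_repair k n \<Sigma> l D (\<rho> l D))"

definition universal_repairability ::
  "nat \<Rightarrow> nat \<Rightarrow> nat \<Rightarrow> ('k, 's) sharing_scheme
     \<Rightarrow> (nat \<Rightarrow> nat set \<Rightarrow> ('s, 'r, 'm) repair_protocol) \<Rightarrow> bool" where
  "universal_repairability k n d \<Sigma> \<rho> \<longleftrightarrow>
     (\<forall>l\<in>{1..n}. \<forall>D\<subseteq>{1..n} - {l}. card D = d \<longrightarrow> secure_repair k n \<Sigma> l D (\<rho> l D))"

end

theory Submission
  imports Defs
begin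

text \<open>
  Lagrange interpolation writes the lost share as \<open>\<Sum>i\<in>D. c\<^sub>i * f i\<close>. Each helper \<open>i\<close> splits
  \<open>c\<^sub>i * f i\<close> additively at random into one piece for each helper, and each helper sends \<open>l\<close> the
  sum of the pieces it holds.

  For privacy, let \<open>p\<close> be the polynomial of degree \<open>k - 1\<close> that vanishes at the \<open>k - 1\<close> points of
  the coalition and takes the value \<open>s' - s\<close> at \<open>0\<close>. Adding \<open>p\<close> to the dealer's polynomial turns
  sharings of \<open>s\<close> into sharings of \<open>s'\<close>. Some helper \<open>h\<close> lies outside the coalition; let every
  helper \<open>i\<close> put the change \<open>c\<^sub>i * p(x\<^sub>i)\<close> into the piece that it gives to \<open>h\<close>. Only the reply of
  \<open>h\<close> can change, and it changes by \<open>p(x\<^sub>l)\<close>, which is zero if the coalition contains \<open>l\<close> and can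
  see this reply. This measure-preserving translation therefore fixes the view of the coalition.
\<close>

subsection \<open>Polynomials over a field\<close>

text \<open>Evaluation at \<open>y = 0\<close> serves to reconstruct the secret, at
  \<open>y = x l\<close> to repair a share.\<close>

definition lagrange_weight :: "('i \<Rightarrow> 'a::field) \<Rightarrow> 'i set \<Rightarrow> 'a \<Rightarrow> 'i \<Rightarrow> 'a" where
  "lagrange_weight x D y i = (\<Prod>j\<in>D - {i}. (y - x j) / (x i - x j))"

text \<open>The interpolant \<open>q\<close> built from the basis polynomials agrees with
  \<open>p\<close> at \<open>card D\<close> distinct nodes, and both have smaller degree, so they
  coincide.\<close>

lemma lagrange_interpolation:
  fixes p :: "'a::field poly"
  assumes "finite D" "inj_on x D" "degree p < card D"
  shows "poly p y = (\<Sum>i\<in>D. lagrange_weight x D y i * poly p (x i))"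
proof -
  define b where "b i = (\<Prod>j\<in>D - {i}. Polynomial.smult (inverse (x i - x j)) [:- x j, 1:])" for i
  define q where "q = (\<Sum>i\<in>D. Polynomial.smult (poly p (x i)) (b i))"
  have poly_b: "poly (b i) z = lagrange_weight x D z i" for i z
    by (simp add: b_def lagrange_weight_def poly_prod divide_inverse algebra_simps)
  have "degree (b i) < card D" if "i \<in> D" for i
  proof -
    have "degree (b i) \<le> (\<Sum>j\<in>D - {i}. degree (Polynomial.smult (inverse (x i - x j)) [:- x j, 1:]))"
      unfolding b_def using degree_prod_sum_le[of "D - {i}" "\<lambda>j. Polynomial.smult (inverse (x i - x j)) [:- x j, 1:]"] assms(1)
      by (simp only: o_def finite_Diff)
    also have "\<dots> \<le> (\<Sum>j\<in>D - {i}. 1)"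
      by (intro sum_mono) auto
    also have "\<dots> < card D"
      using card_Diff1_less[OF assms(1) that] by simp
    finally show ?thesis .
  qed
  then have "degree q < card D"
    unfolding q_def using assms(3)
    by (intro degree_sum_less) (auto intro: le_less_trans[OF degree_smult_le])
  moreover have "poly q (x j) = poly p (x j)" if "j \<in> D" for j
  proof -
    have "lagrange_weight x D (x j) i = (if i = j then 1 else 0)" if "i \<in> D" for i
    proof (cases "i = j")
      case True
      have "x j - x m \<noteq> 0" if "m \<in> D - {j}" for m
        using that \<open>j \<in> D\<close> assms(2) by (auto dest: inj_onD)
      then show ?thesis
        using True by (simp add: lagrange_weight_def)
    next
      case False
      then show ?thesis
        using \<open>j \<in> D\<close> assms(1) by (auto simp: lagrange_weight_def intro!: prod_zero)
    qed
    then have "poly q (x j) = (\<Sum>i\<in>D. if i = j then poly p (x i) else 0)"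
      unfolding q_def poly_sum by (intro sum.cong) (auto simp: poly_b)
    then show ?thesis
      using that assms(1) by simp
  qed
  ultimately have "p = q"
    using assms by (intro poly_eqI_degree[of "x ` D"]) (auto simp: card_image)
  then have "poly p y = poly q y"
    by simp
  then show ?thesis
    by (simp add: q_def poly_sum poly_b mult.commute)
qed

text \<open>Since the nodes are nonzero, the product of the factors \<open>[:- x i, 1:]\<close> is
  nonzero at 0 and can be scaled to any value there. With k - 1 nodes the degree stays below k, so
  \<open>p\<close> can be added to a dealer's polynomial.\<close>

lemma exists_poly_vanishing_on:
  fixes x :: "'i \<Rightarrow> 'a::field"
  assumes "finite C" "\<forall>i\<in>C. x i \<noteq> 0"
  obtains p where "degree p \<le> card C" "poly p 0 = c" "\<forall>i\<in>C. poly p (x i) = 0"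
proof
  define p where "p = Polynomial.smult (c / (\<Prod>i\<in>C. - x i)) (\<Prod>i\<in>C. [:- x i, 1:])"
  have "degree (\<Prod>i\<in>C. [:- x i, 1:]) \<le> (\<Sum>i\<in>C. degree [:- x i, 1:])"
    using degree_prod_sum_le[OF assms(1), of "\<lambda>i. [:- x i, 1:]"] by (simp add: o_def)
  then show "degree p \<le> card C"
    by (simp add: p_def)
  show "poly p 0 = c"
    using assms by (simp add: p_def poly_prod)
  show "\<forall>i\<in>C. poly p (x i) = 0"
    using assms(1) by (auto simp: p_def poly_prod intro!: prod_zero)
qed

lemma poly_eq_sum_lessThan:
  fixes p :: "'a::comm_semiring_1 poly"
  assumes "degree p < k"
  shows "poly p y = (\<Sum>j<k. poly.coeff p j * y ^ j)"
  unfolding poly_altdef using assms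
  by (intro sum.mono_neutral_left) (auto simp: coeff_eq_0)

subsection \<open>Translations of uniform distributions\<close>

text \<open>Independent coordinates can be transformed one by one. The default \<open>d'\<close> is
  arbitrary because the conditional overwrites every value outside \<open>A\<close>.\<close>

lemma map_pmf_Pi_pmf:
  assumes "finite A"
  shows "map_pmf (\<lambda>f i. if i \<in> A then g i (f i) else d) (Pi_pmf A d' p) =
    Pi_pmf A d (\<lambda>i. map_pmf (g i) (p i))"
  using assms by (simp add: map_pmf_def Pi_pmf_bind[where d' = d'])

lemma map_pmf_add_uniform:
  "map_pmf (\<lambda>y. y + c) (pmf_of_set UNIV) = pmf_of_set (UNIV :: 'a::{group_add,finite} set)"
proof (rule map_pmf_of_set_bij_betw)
  show "bij (\<lambda>y. y + c)"
    by (rule bij_betw_byWitness[where f' = "\<lambda>y. y - c"]) auto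
qed auto

lemma map_pmf_add_Pi_uniform:
  fixes c :: "'i \<Rightarrow> 'a::{group_add,finite}"
  assumes "finite A"
  shows "map_pmf (\<lambda>f i. if i \<in> A then f i + c i else d) (Pi_pmf A d (\<lambda>_. pmf_of_set UNIV)) =
    Pi_pmf A d (\<lambda>_. pmf_of_set UNIV)"
  using map_pmf_Pi_pmf[OF assms, of "\<lambda>i y. y + c i"] by (simp add: map_pmf_add_uniform)

text \<open>The elements 0 and 1 differ. This makes the divisor nonzero in the information rate and
  in the communication complexity.\<close>

lemma log_card_field_neq_0: "log 2 (real CARD('a::{field,finite})) \<noteq> 0"
proof -
  have "card {0, 1 :: 'a} \<le> CARD('a)"
    by (intro card_mono) auto
  then have "log 2 (real CARD('a)) > 0"
    by simp
  then show ?thesis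
    by linarith
qed

subsection \<open>The Shamir scheme\<close>

lemma secrets_shamir [simp]: "secrets (shamir k n x) = UNIV"
  and shares_shamir [simp]: "shares (shamir k n x) = UNIV"
  by (simp_all add: shamir_def)

lemma dealt_shares_poly:
  fixes x :: "nat \<Rightarrow> 'a::{field,finite}"
  assumes "f \<in> set_pmf (deal (shamir k n x) s)" "0 < k"
  obtains q where "degree q < k" "poly q 0 = s" "\<forall>i\<in>{1..n}. f i = poly q (x i)"
proof -
  obtain a :: "nat \<Rightarrow> 'a" where f: "f = (\<lambda>i\<in>{1..n}. \<Sum>j<k. (a(0 := s)) j * x i ^ j)"
    using assms(1) by (auto simp: shamir_def)
  define q where "q = (\<Sum>j<k. Polynomial.monom ((a(0 := s)) j) j)"
  have poly_q: "poly q y = (\<Sum>j<k. (a(0 := s)) j * y ^ j)" for y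
    by (simp add: q_def poly_sum poly_monom)
  have "degree q < k"
    unfolding q_def using assms(2)
    by (intro degree_sum_less) (auto intro: le_less_trans[OF degree_monom_le])
  \<comment> \<open>At 0 only the term with \<open>j = 0\<close> survives; it is present because
    \<open>0 < k\<close>.\<close>
  moreover have "poly q 0 = (\<Sum>j<k. if j = 0 then s else 0)"
    unfolding poly_q by (intro sum.cong) auto
  then have "poly q 0 = s"
    using assms(2) by simp
  moreover have "\<forall>i\<in>{1..n}. f i = poly q (x i)"
    using f poly_q by simp
  ultimately show ?thesis
    using that by blast
qed

text \<open>Adding \<open>p\<close> shifts the coefficients: those of positive index are uniform and
  remain so, and the constant one moves from \<open>s\<close> to \<open>s'\<close>.\<close>

lemma deal_shamir_translate:
  fixes x :: "nat \<Rightarrow> 'a::{field,finite}"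
  assumes "degree p < k" "poly p 0 = s' - s"
  shows "map_pmf (\<lambda>f. \<lambda>i\<in>{1..n}. f i + poly p (x i)) (deal (shamir k n x) s) =
    deal (shamir k n x) s'"
proof -
  let ?u = "Pi_pmf {1..<k} 0 (\<lambda>_. pmf_of_set (UNIV :: 'a set))"
  \<comment> \<open>Index 0 keeps the default 0 of the product distribution; the update by the
    secret hides it.\<close>
  let ?t = "\<lambda>(a :: nat \<Rightarrow> 'a) j. if j \<in> {1..<k} then a j + poly.coeff p j else 0"
  let ?share = "\<lambda>(s :: 'a) a. \<lambda>i\<in>{1..n}. \<Sum>j<k. (a(0 := s)) j * x i ^ j"
  have deal_eq: "deal (shamir k n x) s = map_pmf (?share s) ?u" for s
    by (simp add: shamir_def)
  have *: "(\<lambda>i\<in>{1..n}. ?share s a i + poly p (x i)) = ?share s' (?t a)" for a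
  proof -
    have "(a(0 := s)) j * y ^ j + poly.coeff p j * y ^ j = ((?t a)(0 := s')) j * y ^ j"
      if "j < k" for j and y
      using that assms(2) by (auto simp: poly_0_coeff_0 distrib_right)
    then have "(\<Sum>j<k. (a(0 := s)) j * y ^ j) + poly p y = (\<Sum>j<k. ((?t a)(0 := s')) j * y ^ j)"
      for y
      unfolding poly_eq_sum_lessThan[OF assms(1)] sum.distrib[symmetric]
      by (intro sum.cong) auto
    then show ?thesis
      by (intro restrict_ext) (simp only: restrict_apply')
  qed
  have "map_pmf (\<lambda>f. \<lambda>i\<in>{1..n}. f i + poly p (x i)) (deal (shamir k n x) s) =
      map_pmf (?share s') (map_pmf ?t ?u)"
    unfolding deal_eq map_pmf_comp * ..
  also have "map_pmf ?t ?u = ?u"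
    by (rule map_pmf_add_Pi_uniform) simp
  finally show ?thesis
    unfolding deal_eq .
qed

text \<open>Both claims evaluate the same dealt polynomial, which k shares determine.\<close>

lemma dealt_share_interpolate:
  fixes x :: "nat \<Rightarrow> 'a::{field,finite}"
  assumes "f \<in> set_pmf (deal (shamir k n x) s)" "0 < k" "inj_on x {1..n}"
    and "A \<subseteq> {1..n}" "card A = k"
  shows "(\<Sum>i\<in>A. lagrange_weight x A 0 i * f i) = s"
    and "l \<in> {1..n} \<Longrightarrow> (\<Sum>i\<in>A. lagrange_weight x A (x l) i * f i) = f l"
proof -
  obtain q where q: "degree q < k" "poly q 0 = s" "\<forall>i\<in>{1..n}. f i = poly q (x i)"
    using dealt_shares_poly[OF assms(1,2)] .
  have "finite A" "inj_on x A"
    using finite_subset[OF assms(4)] inj_on_subset[OF assms(3,4)] by simp_all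
  then have "poly q y = (\<Sum>i\<in>A. lagrange_weight x A y i * poly q (x i))" for y
    using lagrange_interpolation q(1) assms(5) by blast
  also have "\<dots> y = (\<Sum>i\<in>A. lagrange_weight x A y i * f i)" for y
    using q(3) assms(4) by (intro sum.cong) auto
  finally have *: "(\<Sum>i\<in>A. lagrange_weight x A y i * f i) = poly q y" for y
    by (rule sym)
  show "(\<Sum>i\<in>A. lagrange_weight x A 0 i * f i) = s"
    and "l \<in> {1..n} \<Longrightarrow> (\<Sum>i\<in>A. lagrange_weight x A (x l) i * f i) = f l"
    unfolding * using q(2,3) by simp_all
qed

lemma threshold_scheme_shamir:
  fixes x :: "nat \<Rightarrow> 'a::{field,finite}"
  assumes "2 \<le> k" "k \<le> n" "inj_on x {1..n}" "\<forall>i\<in>{1..n}. x i \<noteq> 0"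
  shows "threshold_scheme k n (shamir k n x)"
proof -
  have "\<exists>reconstruct. \<forall>s. \<forall>f\<in>set_pmf (deal (shamir k n x) s). reconstruct (restrict f A) = s"
    if "A \<subseteq> {1..n}" "card A = k" for A
    using dealt_share_interpolate(1)[OF _ _ assms(3) that] assms(1)
    by (intro exI[of _ "\<lambda>g. \<Sum>i\<in>A. lagrange_weight x A 0 i * g i"]) simp
  moreover have "map_pmf (\<lambda>f. restrict f A) (deal (shamir k n x) s) =
      map_pmf (\<lambda>f. restrict f A) (deal (shamir k n x) s')"
    if A: "A \<subseteq> {1..n}" "card A = k - 1" for A s s'
  proof -
    obtain p where p: "degree p \<le> card A" "poly p 0 = s' - s" "\<forall>i\<in>A. poly p (x i) = 0"
      using exists_poly_vanishing_on[of A x] A(1) assms(4) by (metis finite_atLeastAtMost finite_subset subsetD)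
    \<comment> \<open>The translation changes the secret but not the shares held in
      \<open>A\<close>.\<close>
    have "restrict (\<lambda>i\<in>{1..n}. f i + poly p (x i)) A = restrict f A" for f
      using A(1) p(3) by (auto simp: restrict_def fun_eq_iff subset_iff)
    then show ?thesis
      using p(1,2) A(2) assms(1)
      by (subst deal_shamir_translate[where p = p and s = s, symmetric]) (simp_all add: map_pmf_comp)
  qed
  ultimately show ?thesis
    using assms(1,2) by (simp add: threshold_scheme_def)
qed

subsection \<open>Repair by additive resharing\<close>

text \<open>\<open>r i j\<close> is the piece that \<open>i\<close> gives to \<open>j\<close>. The piece that \<open>i\<close> keeps is not part of the
  randomness: it is what is left of the weighted share, and it enters the reply of \<open>i\<close>.\<close>

definition resharing ::
  "(nat \<Rightarrow> 'a::{field,finite}) \<Rightarrow> nat \<Rightarrow> nat set \<Rightarrow> ('a, nat \<Rightarrow> 'a, 'a) repair_protocol" where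
  "resharing x l D =
     \<lparr> links = {(i, j). i \<in> D \<and> j \<in> D \<and> i \<noteq> j},
       randomness = (\<lambda>i. Pi_pmf (D - {i}) 0 (\<lambda>_. pmf_of_set UNIV)),
       exchange = (\<lambda>i j y \<rho>. \<rho> j),
       reply = (\<lambda>i y \<rho> m. lagrange_weight x D (x l) i * y - (\<Sum>j\<in>D - {i}. \<rho> j) + (\<Sum>j\<in>D - {i}. m j)),
       recover = (\<lambda>m. \<Sum>i\<in>D. m i) \<rparr>"

lemma links_resharing: "links (resharing x l D) = {(i, j). i \<in> D \<and> j \<in> D \<and> i \<noteq> j}"
  by (simp add: resharing_def)

lemma exchanged_resharing:
  "exchanged (resharing x l D) f r = (\<lambda>(i, j)\<in>{(i, j). i \<in> D \<and> j \<in> D \<and> i \<noteq> j}. r i j)"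
  by (simp add: exchanged_def resharing_def)

lemma replies_resharing:
  "replies D (resharing x l D) f r = (\<lambda>i\<in>D. lagrange_weight x D (x l) i * f i
     - (\<Sum>j\<in>D - {i}. r i j) + (\<Sum>j\<in>D - {i}. r j i))"
proof -
  have "(\<Sum>j\<in>D - {i}. received (resharing x l D) f r i j) = (\<Sum>j\<in>D - {i}. r j i)" if "i \<in> D" for i
    using that by (intro sum.cong) (auto simp: received_def exchanged_resharing links_resharing)
  then show ?thesis
    \<comment> \<open>Only the field \<open>reply\<close> is unfolded, so that
      \<open>received\<close> still matches the fact above.\<close>
    by (auto simp: replies_def resharing_def[of x l D, THEN arg_cong[of _ _ reply]])
qed

text \<open>Each piece sent is subtracted by its sender and added by its receiver, so all of them
  cancel in the total.\<close>

lemma sum_replies_resharing: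
  assumes "finite D"
  shows "(\<Sum>i\<in>D. replies D (resharing x l D) f r i) = (\<Sum>i\<in>D. lagrange_weight x D (x l) i * f i)"
proof -
  have "(\<Sum>i\<in>D. \<Sum>j\<in>D - {i}. r i j) = (\<Sum>i\<in>D. \<Sum>j\<in>D - {i}. r j i)"
    using assms by (simp add: sum_diff1 sum_subtractf) (rule sum.swap)
  then show ?thesis
    by (simp add: replies_resharing sum.distrib sum_subtractf)
qed

lemma view_resharing_translate:
  fixes x :: "nat \<Rightarrow> 'a::{field,finite}"
  assumes "C \<subseteq> {1..n}" "D \<subseteq> {1..n}" "h \<in> D" "h \<notin> C"
    and p: "\<forall>i\<in>C. poly p (x i) = 0"
    and sum_p: "(\<Sum>i\<in>D. lagrange_weight x D (x l) i * poly p (x i)) = poly p (x l)"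
  defines "v \<equiv> \<lambda>i. lagrange_weight x D (x l) i * poly p (x i)"
  assumes f': "\<And>i. i \<in> {1..n} \<Longrightarrow> f' i = f i + poly p (x i)"
    and r': "\<And>i j. i \<in> D \<Longrightarrow> j \<in> D - {i} \<Longrightarrow> r' i j = r i j + (if j = h then v i else 0)"
  shows "view l D (resharing x l D) C (f', r') = view l D (resharing x l D) C (f, r)"
proof -
  have fin: "finite D"
    using assms(2) finite_subset by blast
  have "restrict f' C = restrict f C"
    using assms(1) p by (intro restrict_ext) (auto simp: f')
  moreover have "restrict (exchanged (resharing x l D) f' r')
        {(i, j) \<in> links (resharing x l D). i \<in> C \<or> j \<in> C} =
      restrict (exchanged (resharing x l D) f r)
        {(i, j) \<in> links (resharing x l D). i \<in> C \<or> j \<in> C}"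
    \<comment> \<open>A visible piece is sent from inside \<open>C\<close>, where
      \<open>v i = 0\<close>, or goes into \<open>C\<close>, hence not to \<open>h\<close>.\<close>
    using assms(4) p by (intro restrict_ext) (auto simp: exchanged_resharing links_resharing v_def r')
  moreover have "replies D (resharing x l D) f' r' i = replies D (resharing x l D) f r i"
    if i: "i \<in> D" "i \<in> C \<or> l \<in> C" for i
  proof -
    have "(\<Sum>j\<in>D - {i}. r' i j) = (\<Sum>j\<in>D - {i}. r i j + (if j = h then v i else 0))"
      using i(1) by (intro sum.cong) (auto simp: r')
    \<comment> \<open>For \<open>i = h\<close> the piece for \<open>h\<close> is the one kept, which
      is not among the summands.\<close>
    also have "\<dots> = (\<Sum>j\<in>D - {i}. r i j) + (if i = h then 0 else v i)"
      using fin assms(3) by (simp add: sum.distrib)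
    finally have sent: "(\<Sum>j\<in>D - {i}. r' i j) = (\<Sum>j\<in>D - {i}. r i j) + (if i = h then 0 else v i)" .
    have "(\<Sum>j\<in>D - {i}. r' j i) = (\<Sum>j\<in>D - {i}. r j i + (if i = h then v j else 0))"
      using i(1) by (intro sum.cong) (auto simp: r')
    also have "\<dots> = (\<Sum>j\<in>D - {i}. r j i) + (if i = h then (\<Sum>j\<in>D. v j) - v i else 0)"
      using fin i(1) by (simp add: sum.distrib sum_diff1)
    finally have got: "(\<Sum>j\<in>D - {i}. r' j i) =
      (\<Sum>j\<in>D - {i}. r j i) + (if i = h then (\<Sum>j\<in>D. v j) - v i else 0)" .
    \<comment> \<open>As \<open>h\<close> is outside \<open>C\<close>, its reply is visible only if
      \<open>l \<in> C\<close>, and then \<open>poly p (x l) = 0\<close>. For any other helper the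
      change \<open>v i\<close> of the weighted share cancels against the change of the pieces
      sent.\<close>
    have "i = h \<Longrightarrow> (\<Sum>j\<in>D. v j) = 0"
      using i(2) assms(4) p sum_p by (auto simp: v_def)
    moreover have "lagrange_weight x D (x l) i * f' i = lagrange_weight x D (x l) i * f i + v i"
      using i(1) assms(2) f' by (auto simp: v_def distrib_left)
    ultimately show ?thesis
      using i(1) sent got by (auto simp: replies_resharing)
  qed
  then have "restrict (replies D (resharing x l D) f' r') {i \<in> D. i \<in> C \<or> l \<in> C} =
      restrict (replies D (resharing x l D) f r) {i \<in> D. i \<in> C \<or> l \<in> C}"
    by (intro restrict_ext) auto
  ultimately show ?thesis
    by (simp add: view_def)
qed

lemma view_resharing_indep_secret:
  fixes x :: "nat \<Rightarrow> 'a::{field,finite}"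
  assumes "0 < k" "inj_on x {1..n}" "\<forall>i\<in>{1..n}. x i \<noteq> 0"
    and D: "D \<subseteq> {1..n}" "card D = k" and C: "C \<subseteq> {1..n}" "card C = k - 1"
  shows "map_pmf (view l D (resharing x l D) C) (execution (shamir k n x) D (resharing x l D) s) =
    map_pmf (view l D (resharing x l D) C) (execution (shamir k n x) D (resharing x l D) s')"
proof -
  let ?P = "resharing x l D"
  have fin: "finite C" "finite D"
    using C(1) D(1) finite_subset by blast+
  obtain p where p: "degree p \<le> card C" "poly p 0 = s' - s" "\<forall>i\<in>C. poly p (x i) = 0"
    using exists_poly_vanishing_on[of C x] fin C(1) assms(3) by (metis subsetD)
  have deg: "degree p < k"
    using p(1) C(2) assms(1) by linarith
  \<comment> \<open>There are k helpers but only k - 1 coalition members.\<close>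
  obtain h where h: "h \<in> D" "h \<notin> C"
    using card_mono[OF fin(1), of D] C(2) D(2) assms(1) by (metis diff_less le_zero_eq less_le_not_le subsetI zero_less_one)
  define v where "v i = lagrange_weight x D (x l) i * poly p (x i)" for i
  define tf where "tf f = (\<lambda>i\<in>{1..n}. f i + poly p (x i))" for f
  \<comment> \<open>The values \<open>0\<close> and \<open>undefined\<close> repeat the defaults of
    the inner and outer product distributions, so that \<open>tr\<close> preserves the randomness
    exactly.\<close>
  define tr where "tr r = (\<lambda>i. if i \<in> D
    then (\<lambda>j. if j \<in> D - {i} then r i j + (if j = h then v i else 0) else 0)
    else undefined)" for r :: "nat \<Rightarrow> nat \<Rightarrow> 'a"
  have "map_pmf (\<lambda>\<rho> j. if j \<in> D - {i} then \<rho> j + (if j = h then v i else 0) else 0) (randomness ?P i) =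
      randomness ?P i" for i
    using map_pmf_add_Pi_uniform[of "D - {i}" "\<lambda>j. if j = h then v i else 0" 0] fin(2)
    by (simp add: resharing_def)
  then have "map_pmf tr (Pi_pmf D undefined (randomness ?P)) = Pi_pmf D undefined (randomness ?P)"
    unfolding tr_def
    by (subst map_pmf_Pi_pmf[OF fin(2), where g =
          "\<lambda>i \<rho> j. if j \<in> D - {i} then \<rho> j + (if j = h then v i else 0) else 0"]) (simp only:)
  moreover have "map_pmf tf (deal (shamir k n x) s) = deal (shamir k n x) s'"
    unfolding tf_def by (rule deal_shamir_translate[OF deg p(2)])
  ultimately have "execution (shamir k n x) D ?P s' =
      map_pmf (map_prod tf tr) (execution (shamir k n x) D ?P s)"
    by (simp add: execution_def map_prod_def map_pair)
  moreover have "view l D ?P C (tf f, tr r) = view l D ?P C (f, r)" for f r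
  proof (rule view_resharing_translate[OF C(1) D(1) h p(3)])
    show "(\<Sum>i\<in>D. lagrange_weight x D (x l) i * poly p (x i)) = poly p (x l)"
      using lagrange_interpolation[of D x p] fin deg D assms(2) by (metis inj_on_subset)
  qed (auto simp: tf_def tr_def v_def)
  ultimately show ?thesis
    by (auto simp: map_pmf_comp intro!: map_pmf_cong)
qed

lemma secure_repair_resharing:
  fixes x :: "nat \<Rightarrow> 'a::{field,finite}"
  assumes "0 < k" "inj_on x {1..n}" "\<forall>i\<in>{1..n}. x i \<noteq> 0"
    and "l \<in> {1..n}" "D \<subseteq> {1..n}" "card D = k"
  shows "secure_repair k n (shamir k n x) l D (resharing x l D)"
proof -
  have "recover (resharing x l D) (replies D (resharing x l D) f r) = f l"
    if "f \<in> set_pmf (deal (shamir k n x) s)" for s f r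
  proof -
    have "recover (resharing x l D) m = (\<Sum>i\<in>D. m i)" for m
      by (simp add: resharing_def)
    moreover have "finite D"
      using assms(5) finite_subset by blast
    ultimately show ?thesis
      using dealt_share_interpolate(2)[OF that assms(1,2,5,6,4)] by (simp add: sum_replies_resharing)
  qed
  then show ?thesis
    unfolding secure_repair_def
    using view_resharing_indep_secret[OF assms(1-3,5,6)]
    by (auto simp: links_resharing execution_def)
qed

subsection \<open>Communication complexity\<close>

text \<open>Uniform pieces can take any value, so only the default values constrain the
  support.\<close>

lemma execution_resharing_support:
  fixes r :: "nat \<Rightarrow> nat \<Rightarrow> 'a::{field,finite}"
  assumes "finite D" "f \<in> set_pmf (deal \<Sigma> s)"
    and "\<And>i. i \<notin> D \<Longrightarrow> r i = undefined" "\<And>i j. i \<in> D \<Longrightarrow> j \<notin> D - {i} \<Longrightarrow> r i j = 0"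
  shows "(f, r) \<in> set_pmf (execution \<Sigma> D (resharing x l D) s)"
  using assms by (auto simp: execution_def resharing_def set_Pi_pmf PiE_dflt_def)

lemma exchange_messages_resharing:
  fixes x :: "nat \<Rightarrow> 'a::{field,finite}"
  assumes "finite D" "e \<in> links (resharing x l D)"
  shows "exchange_messages (shamir k n x) D (resharing x l D) e = UNIV"
proof -
  obtain i j where e: "e = (i, j)" "i \<in> D" "j \<in> D" "i \<noteq> j"
    using assms(2) by (auto simp: links_resharing)
  obtain f where f: "f \<in> set_pmf (deal (shamir k n x) 0)"
    using set_pmf_not_empty by fast
  have "c \<in> exchange_messages (shamir k n x) D (resharing x l D) e" for c
  proof -
    define r where "r m = (if m \<in> D then (\<lambda>m'. if m = i \<and> m' = j then c else 0) else undefined)" for m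
    have "(f, r) \<in> set_pmf (execution (shamir k n x) D (resharing x l D) 0)"
      using assms(1) f e by (intro execution_resharing_support) (auto simp: r_def)
    moreover have "exchanged (resharing x l D) f r e = c"
      using e by (simp add: exchanged_resharing r_def)
    ultimately show ?thesis
      unfolding exchange_messages_def by force
  qed
  then show ?thesis
    by blast
qed

text \<open>A second helper \<open>h\<close> can steer the reply of \<open>i\<close> to any value
  through the piece it sends to \<open>i\<close>.\<close>

lemma reply_messages_resharing:
  fixes x :: "nat \<Rightarrow> 'a::{field,finite}"
  assumes "finite D" "i \<in> D" "h \<in> D" "h \<noteq> i"
  shows "reply_messages (shamir k n x) D (resharing x l D) i = UNIV"
proof -
  obtain f where f: "f \<in> set_pmf (deal (shamir k n x) 0)"
    using set_pmf_not_empty by fast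
  have "c \<in> reply_messages (shamir k n x) D (resharing x l D) i" for c
  proof -
    \<comment> \<open>With all other pieces zero, \<open>b\<close> is what the reply lacks to equal
      \<open>c\<close>.\<close>
    define b where "b = c - lagrange_weight x D (x l) i * f i"
    define r where "r m = (if m \<in> D then (\<lambda>m'. if m = h \<and> m' = i then b else 0) else undefined)" for m
    have "(f, r) \<in> set_pmf (execution (shamir k n x) D (resharing x l D) 0)"
      using assms f by (intro execution_resharing_support) (auto simp: r_def)
    moreover have "(\<Sum>j\<in>D - {i}. r i j) = 0"
      using assms by (intro sum.neutral) (auto simp: r_def)
    moreover have "(\<Sum>j\<in>D - {i}. r j i) = (\<Sum>j\<in>D - {i}. if j = h then b else 0)"
      by (intro sum.cong) (auto simp: r_def)
    then have "(\<Sum>j\<in>D - {i}. r j i) = b"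
      using assms by simp
    ultimately have "replies D (resharing x l D) f r i = c"
      and "(f, r) \<in> set_pmf (execution (shamir k n x) D (resharing x l D) 0)"
      using assms(2) by (simp_all add: replies_resharing b_def)
    then show ?thesis
      unfolding reply_messages_def by force
  qed
  then show ?thesis
    by blast
qed

text \<open>Every message ranges over the whole field and so costs as much as a secret. With d
  helpers there are d(d - 1) exchanged pieces and d replies.\<close>

lemma communication_complexity_resharing:
  fixes x :: "nat \<Rightarrow> 'a::{field,finite}"
  assumes "2 \<le> card D"
  shows "communication_complexity (shamir k n x) D (resharing x l D) = real ((card D)\<^sup>2)"
proof -
  have fin: "finite D"
    using assms by (intro card_ge_0_finite) simp
  have "reply_messages (shamir k n x) D (resharing x l D) i = UNIV" if "i \<in> D" for i
  proof -
    have "D - {i} \<noteq> {}"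
      using assms that fin by (metis One_nat_def card_Diff_singleton card.empty diff_is_0_eq
          not_less_eq_eq numeral_2_eq_2)
    then show ?thesis
      using reply_messages_resharing[OF fin that] by blast
  qed
  moreover have "card (links (resharing x l D)) = card D * card D - card D"
  proof -
    have "links (resharing x l D) = D \<times> D - (\<lambda>i. (i, i)) ` D"
      by (auto simp: links_resharing)
    then show ?thesis
      using fin by (simp add: card_Diff_subset image_subset_iff card_image inj_on_def)
  qed
  moreover have "log 2 (real CARD('a)) \<noteq> 0"
    by (rule log_card_field_neq_0)
  ultimately show ?thesis
    unfolding communication_complexity_def
    using fin by (simp add: exchange_messages_resharing of_nat_diff field_simps power2_eq_square)
qed

theorem mainTheorem1:
  fixes k n Q :: nat and x :: "nat \<Rightarrow> 'a::{field,finite}"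
  assumes "2 \<le> k" and "k < n"
    and "primepow Q" and "Q \<ge> n + 1"
    and "CARD('a) = Q"
    and "inj_on x {1..n}" and "\<forall>i\<in>{1..n}. x i \<noteq> 0"
  shows "information_rate (shamir k n x) = 1 \<and>
    (\<exists>\<rho> :: nat \<Rightarrow> nat set \<Rightarrow> ('a, nat \<Rightarrow> 'a, 'a) repair_protocol.
       repairable_threshold_scheme k n k (shamir k n x) \<rho> \<and>
       universal_repairability k n k (shamir k n x) \<rho> \<and>
       (\<forall>l\<in>{1..n}. \<forall>D\<subseteq>{1..n} - {l}. card D = k \<longrightarrow>
          communication_complexity (shamir k n x) D (\<rho> l D) = real (k\<^sup>2)))"
proof (intro conjI exI[of _ "resharing x"])
  show "information_rate (shamir k n x) = 1"
    by (simp add: information_rate_def log_card_field_neq_0)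
  have secure: "secure_repair k n (shamir k n x) l D (resharing x l D)"
    if "l \<in> {1..n}" "D \<subseteq> {1..n} - {l}" "card D = k" for l D
    using that assms(1,6,7) by (intro secure_repair_resharing) auto
  then show "universal_repairability k n k (shamir k n x) (resharing x)"
    by (simp add: universal_repairability_def)
  \<comment> \<open>Since \<open>k < n\<close>, at least k players remain besides
    \<open>l\<close>.\<close>
  have "\<exists>D\<subseteq>{1..n} - {l}. card D = k" if "l \<in> {1..n}" for l
  proof -
    have "k \<le> card ({1..n} - {l})"
      using that assms(2) by simp
    then show ?thesis
      by (meson obtain_subset_with_card_n)
  qed
  moreover have "threshold_scheme k n (shamir k n x)"
    using assms by (intro threshold_scheme_shamir) auto
  ultimately show "repairable_threshold_scheme k n k (shamir k n x) (resharing x)"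
    unfolding repairable_threshold_scheme_def using secure by blast
  show "\<forall>l\<in>{1..n}. \<forall>D\<subseteq>{1..n} - {l}. card D = k \<longrightarrow>
      communication_complexity (shamir k n x) D (resharing x l D) = real (k\<^sup>2)"
    using communication_complexity_resharing assms(1) by blast
qed

end
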